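(* Let $D$ be a finite offline dataset of transitions $(s,a,r,s')$ from an MDP $\langle \mathcal{S},\mathcal{A},\mathcal{R},\mathcal{P},\gamma\rangle$ with no terminal states, and let $\pi$ be a deterministic policy. Let $\mathcal{X}$, $R$, $\mathcal{X}'$ be the data matrices whose $k$-th rows are, respectively, $(s,a)$, $r$ and $(s',\pi(s'))$ for the $k$-th transition of $D$. Consider an ensemble of $Q$-networks $Q_{\theta^i}$ (indexed by $i$ ranging over a probability space $Z$), all having the same infinite-width, NTK-parameterized architecture and differing only in their initial weights $\theta^i$, which are drawn independently from the initial weight distribution; $\mathbb{E}$ and $\mathbb{V}$ denote expectation and variance over this draw. Let $\hat{\Theta}^{(0)}(A,B)=\nabla_\theta Q_{\theta^i}(A)\,\nabla_\theta Q_{\theta^i}(B)^T|_{t=0}$ be the (deterministic, member-independent) neural tangent kernel at initialization, and set $C := \hat{\Theta}^{(0)}(\mathcal{X}',\mathcal{X})\,\hat{\Theta}^{(0)}(\mathcal{X},\mathcal{X})^{-1}$. Write $Q^{(0)}_{\theta^i}$ for the network at initialization and $Q^{(t)}_{\theta^i}$ for the network after $t$ iterations of the following pessimistic policy evaluation procedure: at iteration $t+1$, targets $y^i$ are computed from the iteration-$t$ networks, and each network $Q_{\theta^i}$ is trained from its initialization by gradient descent (with a suitably small learning rate) to convergence on the mean squared error $\frac{1}{|D|}\sum_{(s,a,r,s')\in D}(Q_{\theta^i}(s,a)-y^i(r,s',\pi))^2$. Two choices of targets are considered: (Method 1, independent targets) $y^i = r + \gamma\, Q^{(t)}_{\theta^i}(s',\pi(s'))$;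 (Method 2, shared targets) $y^i = r + \gamma\big(\mathbb{E}[Q^{(t)}_{\theta^i}(s',\pi(s'))] - \sqrt{\mathbb{V}[Q^{(t)}_{\theta^i}(s',\pi(s'))]}\big)$, the same for all $i$. In both cases define $Q^{(t)}_{\mathrm{LCB}}(s,a) = \mathbb{E}[Q^{(t)}_{\theta^i}(s,a)] - \sqrt{\mathbb{V}[Q^{(t)}_{\theta^i}(s,a)]}$. Then, after $t+1$ iterations, with $1$ denoting the identity matrix and squares and square roots taken element-wise: for Method 1, $$Q^{(t+1)}_{\mathrm{LCB}}(\mathcal{X}') = \mathcal{O}(\gamma^t\|C\|^t) + (1+\gamma C+\dots+\gamma^t C^t)\,C R - \sqrt{\mathbb{E}\Big[\Big((1+\gamma C+\dots+\gamma^t C^t)\big(Q^{(0)}_{\theta^i}(\mathcal{X}') - C\,Q^{(0)}_{\theta^i}(\mathcal{X})\big)\Big)^2\Big]};$$ for Method 2, $$Q^{(t+1)}_{\mathrm{LCB}}(\mathcal{X}') = \mathcal{O}(\gamma^t\|C\|^t) + (1+\gamma C+\dots+\gamma^t C^t)\,C R - (1+\gamma C+\dots+\gamma^t C^t)\sqrt{\mathbb{E}\Big[\big(Q^{(0)}_{\theta^i}(\mathcal{X}') - C\,Q^{(0)}_{\theta^i}(\mathcal{X})\big)^2\Big]}.$$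
   Context: Notation such as $Q(\mathcal{X})$ means the column vector obtained by applying $Q$ to each row of $\mathcal{X}$. The NTK parameterization and infinite-width limit are in the sense of Jacot et al.; in this limit the kernel $\hat{\Theta}^{(0)}$ converges to a deterministic kernel, identical for all ensemble members. The paper assumes $\gamma\|C\|<1$ (if $\gamma\|C\|\ge 1$ the procedure may diverge), so that the $\mathcal{O}(\gamma^t\|C\|^t)$ term vanishes as $t\to\infty$. *)

theory Defs
  imports "HOL-Analysis.Analysis" "HOL-Probability.Probability"
begin

text \<open>Neural tangent kernel given by the (possibly infinite-dimensional) gradient feature map
  at initialisation: Theta(A,B) = grad Q(A) . grad Q(B).\<close>
definition ntk :: "('x \<Rightarrow> 'h::real_inner) \<Rightarrow> 'x \<Rightarrow> 'x \<Rightarrow> real" where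
  "ntk \<phi> x y = \<phi> x \<bullet> \<phi> y"

text \<open>Data vector f(X): k-th entry is f applied to the k-th row.\<close>
definition datavec :: "('x \<Rightarrow> real) \<Rightarrow> ('n::finite \<Rightarrow> 'x) \<Rightarrow> real^'n" where
  "datavec f X = (\<chi> k. f (X k))"

text \<open>Kernel matrix Theta(A,B).\<close>
definition gram :: "('x \<Rightarrow> 'x \<Rightarrow> real) \<Rightarrow> ('n::finite \<Rightarrow> 'x) \<Rightarrow> ('n \<Rightarrow> 'x) \<Rightarrow> real^'n^'n" where
  "gram \<Theta> A B = (\<chi> k l. \<Theta> (A k) (B l))"

text \<open>Matrix power w.r.t. matrix multiplication.\<close>
primrec matpow :: "real^'n^'n \<Rightarrow> nat \<Rightarrow> real^'n^'n" where
  "matpow A 0 = mat 1"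
| "matpow A (Suc k) = A ** matpow A k"

text \<open>1 + gamma C + ... + gamma^t C^t\<close>
definition geom_sum :: "real \<Rightarrow> real^'n^'n \<Rightarrow> nat \<Rightarrow> real^'n^'n" where
  "geom_sum \<gamma> C t = (\<Sum>k\<le>t. (\<gamma> ^ k) *\<^sub>R matpow C k)"

text \<open>One step of gradient descent (learning rate eta) on the MSE
  (1/|D|) sum_j (Q(X_j) - y_j)^2, in the infinite-width NTK regime, where the network
  function evolves by kernel gradient descent with the (fixed) NTK Theta.\<close>
definition kgd_step :: "('x \<Rightarrow> 'x \<Rightarrow> real) \<Rightarrow> ('n::finite \<Rightarrow> 'x) \<Rightarrow> real \<Rightarrow> real^'n
    \<Rightarrow> ('x \<Rightarrow> real) \<Rightarrow> ('x \<Rightarrow> real)" where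
  "kgd_step \<Theta> X \<eta> y f = (\<lambda>x. f x - \<eta> * (2 / real CARD('n)) *
      (\<Sum>j\<in>UNIV. \<Theta> x (X j) * (f (X j) - y $ j)))"

text \<open>Train from initialisation f0 to convergence on targets y.\<close>
definition ntk_train :: "('x \<Rightarrow> 'x \<Rightarrow> real) \<Rightarrow> ('n::finite \<Rightarrow> 'x) \<Rightarrow> real \<Rightarrow> real^'n
    \<Rightarrow> ('x \<Rightarrow> real) \<Rightarrow> ('x \<Rightarrow> real)" where
  "ntk_train \<Theta> X \<eta> y f0 = (\<lambda>x. lim (\<lambda>m. ((kgd_step \<Theta> X \<eta> y) ^^ m) f0 x))"

text \<open>Ensemble mean, variance and lower confidence bound (over the init distribution M).\<close>
definition ens_mean :: "'z measure \<Rightarrow> ('z \<Rightarrow> real) \<Rightarrow> real" where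
  "ens_mean M f = integral\<^sup>L M f"

definition ens_var :: "'z measure \<Rightarrow> ('z \<Rightarrow> real) \<Rightarrow> real" where
  "ens_var M f = ens_mean M (\<lambda>z. (f z - ens_mean M f)^2)"

definition lcb :: "'z measure \<Rightarrow> ('z \<Rightarrow> 'x \<Rightarrow> real) \<Rightarrow> 'x \<Rightarrow> real" where
  "lcb M Q x = ens_mean M (\<lambda>z. Q z x) - sqrt (ens_var M (\<lambda>z. Q z x))"

text \<open>Method 1: independent targets y^i = r + gamma Q^(t)_i(s',pi(s')).\<close>
primrec pe_indep :: "('x \<Rightarrow> 'x \<Rightarrow> real) \<Rightarrow> ('n::finite \<Rightarrow> 'x) \<Rightarrow> ('n \<Rightarrow> 'x) \<Rightarrow> real
    \<Rightarrow> real^'n \<Rightarrow> real \<Rightarrow> ('z \<Rightarrow> 'x \<Rightarrow> real) \<Rightarrow> nat \<Rightarrow> ('z \<Rightarrow> 'x \<Rightarrow> real)" where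
  "pe_indep \<Theta> X X' \<eta> R \<gamma> Q0 0 = Q0"
| "pe_indep \<Theta> X X' \<eta> R \<gamma> Q0 (Suc t) =
     (\<lambda>z. ntk_train \<Theta> X \<eta> (R + \<gamma> *\<^sub>R datavec (pe_indep \<Theta> X X' \<eta> R \<gamma> Q0 t z) X') (Q0 z))"

text \<open>Method 2: shared pessimistic targets y = r + gamma (E Q^(t) - sqrt V Q^(t)).\<close>
primrec pe_shared :: "'z measure \<Rightarrow> ('x \<Rightarrow> 'x \<Rightarrow> real) \<Rightarrow> ('n::finite \<Rightarrow> 'x) \<Rightarrow> ('n \<Rightarrow> 'x) \<Rightarrow> real
    \<Rightarrow> real^'n \<Rightarrow> real \<Rightarrow> ('z \<Rightarrow> 'x \<Rightarrow> real) \<Rightarrow> nat \<Rightarrow> ('z \<Rightarrow> 'x \<Rightarrow> real)" where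
  "pe_shared M \<Theta> X X' \<eta> R \<gamma> Q0 0 = Q0"
| "pe_shared M \<Theta> X X' \<eta> R \<gamma> Q0 (Suc t) =
     (\<lambda>z. ntk_train \<Theta> X \<eta> (R + \<gamma> *\<^sub>R datavec (lcb M (pe_shared M \<Theta> X X' \<eta> R \<gamma> Q0 t)) X') (Q0 z))"

end

theory Submission
  imports Defs
begin

text \<open>Trained in the NTK regime from an initial network \<open>f0\<close> on targets \<open>y\<close>, the residual on
  the training inputs evolves by \<open>e \<mapsto> e - c G e\<close>, where \<open>G\<close> is the positive definite Gram matrix
  of the gradient features; for small learning rates this is a contraction, and the trained
  network is the kernel regression \<open>f0 x + k(x) \<bullet> G\<^sup>-\<^sup>1 (y - f0(X))\<close>. On the next-state inputs one
  round of training is therefore the affine map \<open>y \<mapsto> f0(X') + C (y - f0(X))\<close>, and both procedures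
  become affine recursions \<open>x(t+1) = b + \<gamma> C x(t)\<close>, solved by the geometric sum applied to \<open>b\<close>
  plus the remainder \<open>\<gamma>^(t+1) C^(t+1) x(0)\<close> of size \<open>O((\<gamma> \<parallel>C\<parallel>)^t)\<close>. The random part of \<open>b\<close> is
  the centred residual \<open>Q0(X') - C Q0(X)\<close>. With independent targets it runs through the
  recursion, and by Minkowski's inequality in \<open>L\<^sup>2\<close> the remainder moves the standard deviation by
  \<open>O((\<gamma> \<parallel>C\<parallel>)^t)\<close> only. With shared targets the standard deviation is subtracted before it
  enters the recursion, so it is propagated by the geometric sum.\<close>

section \<open>Kernel gradient descent\<close>

lemma matrix_inv_left: "invertible A \<Longrightarrow> matrix_inv A ** A = mat 1"
  unfolding invertible_def matrix_inv_def by (rule someI2_ex) auto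

lemma gram_ntk_mult_nth:
  fixes \<phi> :: "'x \<Rightarrow> 'h::real_inner" and X :: "'n::finite \<Rightarrow> 'x"
  shows "(gram (ntk \<phi>) X X *v v) $ i = \<phi> (X i) \<bullet> (\<Sum>j\<in>UNIV. v $ j *\<^sub>R \<phi> (X j))"
  by (simp add: gram_def ntk_def matrix_vector_mult_def inner_sum_right algebra_simps)

lemma inner_gram_ntk_mult:
  fixes \<phi> :: "'x \<Rightarrow> 'h::real_inner" and X :: "'n::finite \<Rightarrow> 'x"
  shows "v \<bullet> (gram (ntk \<phi>) X X *v v) = norm (\<Sum>j\<in>UNIV. v $ j *\<^sub>R \<phi> (X j))^2"
  by (simp add: power2_norm_eq_inner inner_vec_def gram_ntk_mult_nth inner_sum_left sum_distrib_left)

lemma norm_gram_ntk_mult_le: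
  fixes \<phi> :: "'x \<Rightarrow> 'h::real_inner" and X :: "'n::finite \<Rightarrow> 'x"
  shows "norm (gram (ntk \<phi>) X X *v v)^2 \<le> (\<Sum>j\<in>UNIV. norm (\<phi> (X j))^2) * (v \<bullet> (gram (ntk \<phi>) X X *v v))"
proof -
  define w where "w = (\<Sum>j\<in>UNIV. v $ j *\<^sub>R \<phi> (X j))"
  have "norm (gram (ntk \<phi>) X X *v v)^2 = (\<Sum>i\<in>UNIV. (\<phi> (X i) \<bullet> w)^2)"
    by (simp only: power2_norm_eq_inner) (simp add: inner_vec_def gram_ntk_mult_nth w_def power2_eq_square)
  also have "\<dots> \<le> (\<Sum>i\<in>UNIV. norm (\<phi> (X i))^2 * norm w^2)"
    by (intro sum_mono) (metis Cauchy_Schwarz_ineq2 abs_ge_zero power2_abs power_mono power_mult_distrib)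
  finally show ?thesis
    by (simp add: inner_gram_ntk_mult w_def sum_distrib_right)
qed

lemma norm_diff_scaleR_le:
  fixes G :: "'a::real_inner \<Rightarrow> 'a"
  assumes bound_above: "norm (G v)^2 \<le> T * (v \<bullet> G v)"
    and bound_below: "norm v \<le> B * norm (G v)"
    and "0 < c" "c * T \<le> 1" "0 < T" "0 < B"
  shows "norm (v - c *\<^sub>R G v)^2 \<le> (1 - c / (T * B^2)) * norm v^2"
proof -
  have "0 \<le> T * (v \<bullet> G v)"
    using bound_above by (rule order_trans[OF zero_le_power2])
  then have "0 \<le> v \<bullet> G v"
    using \<open>0 < T\<close> by (simp add: zero_le_mult_iff)
  have "norm (v - c *\<^sub>R G v)^2 = norm v^2 - 2 * c * (v \<bullet> G v) + c^2 * norm (G v)^2"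
    by (simp only: power2_norm_eq_inner)
       (simp add: inner_diff_left inner_diff_right inner_commute algebra_simps power2_eq_square)
  also have "\<dots> \<le> norm v^2 - 2 * c * (v \<bullet> G v) + c * (c * T) * (v \<bullet> G v)"
    using mult_left_mono[OF bound_above, of "c^2"] by (simp add: power2_eq_square algebra_simps)
  also have "\<dots> \<le> norm v^2 - c * (v \<bullet> G v)"
    using mult_left_mono[OF \<open>c * T \<le> 1\<close>, of "c * (v \<bullet> G v)"] \<open>0 < c\<close> \<open>0 \<le> v \<bullet> G v\<close>
    by (simp add: algebra_simps)
  also have "\<dots> \<le> norm v^2 - c / T * norm (G v)^2"
    using mult_left_mono[OF bound_above, of "c / T"] \<open>0 < c\<close> \<open>0 < T\<close> by simp
  also have "\<dots> \<le> norm v^2 - c / (T * B^2) * norm v^2"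
  proof -
    have "norm v^2 \<le> B^2 * norm (G v)^2"
      using bound_below by (metis norm_ge_zero power_mono power_mult_distrib)
    then have "norm v^2 / B^2 \<le> norm (G v)^2"
      using \<open>0 < B\<close> by (simp add: field_simps)
    then have "c / T * (norm v^2 / B^2) \<le> c / T * norm (G v)^2"
      using \<open>0 < c\<close> \<open>0 < T\<close> by (intro mult_left_mono) simp_all
    then show ?thesis by simp
  qed
  finally show ?thesis by (simp add: algebra_simps)
qed

lemma invertible_imp_norm_bounded_below:
  fixes G :: "real^'n^'n"
  assumes "invertible G"
  obtains B where "1 \<le> B" "\<And>v. norm v \<le> B * norm (G *v v)"
proof
  let ?B = "onorm (\<lambda>v. matrix_inv G *v v) + 1"
  show "1 \<le> ?B"
    using onorm_pos_le[OF matrix_vector_mul_bounded_linear, of "matrix_inv G"] by simp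
  fix v
  have "norm v = norm (matrix_inv G *v (G *v v))"
    by (simp add: matrix_vector_mul_assoc matrix_inv_left[OF assms])
  also have "\<dots> \<le> onorm (\<lambda>v. matrix_inv G *v v) * norm (G *v v)"
    by (simp add: onorm)
  also have "\<dots> \<le> ?B * norm (G *v v)" by (simp add: mult_right_mono)
  finally show "norm v \<le> ?B * norm (G *v v)" .
qed

lemma LIMSEQ_zero_if_norm_sq_contracts:
  fixes x :: "nat \<Rightarrow> 'a::real_normed_vector"
  assumes "\<And>m. norm (x (Suc m))^2 \<le> q * norm (x m)^2" "0 \<le> q" "q < 1"
  shows "x \<longlonglongrightarrow> 0"
proof -
  have bound: "norm (x m)^2 \<le> q^m * norm (x 0)^2" for m
  proof (induction m)
    case (Suc m)
    then show ?case using assms(1)[of m] mult_left_mono[OF Suc \<open>0 \<le> q\<close>] by simp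
  qed simp
  have "(\<lambda>m. q^m * norm (x 0)^2) \<longlonglongrightarrow> 0"
    using assms(2,3) by (simp add: LIMSEQ_power_zero tendsto_mult_left_zero)
  then have "(\<lambda>m. norm (x m)^2) \<longlonglongrightarrow> 0"
    by (rule Lim_null_comparison[rotated]) (use bound in simp)
  then have "(\<lambda>m. norm (x m)) \<longlonglongrightarrow> 0"
    using tendsto_real_sqrt by fastforce
  then show ?thesis by (simp add: tendsto_norm_zero_iff)
qed

lemma ntk_train_eq:
  fixes \<phi> :: "'x \<Rightarrow> 'h::real_inner" and X :: "'n::finite \<Rightarrow> 'x"
  assumes inv: "invertible (gram (ntk \<phi>) X X)"
    and "0 < \<eta>" "\<eta> < real CARD('n) / (2 * (1 + (\<Sum>j\<in>UNIV. norm (\<phi> (X j))^2)))"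
  shows "ntk_train (ntk \<phi>) X \<eta> y f0 x =
    f0 x + (\<chi> j. ntk \<phi> x (X j)) \<bullet> (matrix_inv (gram (ntk \<phi>) X X) *v (y - datavec f0 X))"
proof -
  define G where "G = gram (ntk \<phi>) X X"
  define T where "T = 1 + (\<Sum>j\<in>UNIV. norm (\<phi> (X j))^2)"
  define c where "c = \<eta> * (2 / real CARD('n))"
  define f where "f m = (kgd_step (ntk \<phi>) X \<eta> y ^^ m) f0" for m
  define e where "e m = datavec (f m) X - y" for m
  define k where "k x = (\<chi> j. ntk \<phi> x (X j))" for x
  have "1 \<le> T" by (simp add: T_def sum_nonneg)
  have "0 < c" "c * T \<le> 1"
    using assms(2,3) \<open>1 \<le> T\<close> by (simp_all add: c_def T_def field_simps)
  have step_f: "f (Suc m) x = f m x - c * (k x \<bullet> e m)" for m x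
    by (simp add: f_def kgd_step_def c_def k_def e_def inner_vec_def datavec_def)
  have step_e: "e (Suc m) = e m - c *\<^sub>R (G *v e m)" for m
    by (simp add: vec_eq_iff e_def datavec_def step_f k_def G_def gram_def
        matrix_vector_mult_def inner_vec_def algebra_simps)
  have f_eq: "f m x = f0 x - k x \<bullet> (matrix_inv G *v (e 0 - e m))" for m x
  proof (induction m arbitrary: x)
    case (Suc m)
    have "matrix_inv G *v (e 0 - e (Suc m)) = matrix_inv G *v (e 0 - e m) + c *\<^sub>R e m"
      by (simp add: step_e algebra_simps matrix_vector_mul_assoc matrix_inv_left inv[folded G_def])
    with Suc show ?case by (simp add: step_f inner_add_right)
  qed (simp add: f_def)
  obtain B where "1 \<le> B" and below: "\<And>v. norm v \<le> B * norm (G *v v)"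
    using invertible_imp_norm_bounded_below inv[folded G_def] by blast
  have above: "norm (G *v v)^2 \<le> T * (v \<bullet> (G *v v))" for v
  proof -
    have "0 \<le> v \<bullet> (G *v v)" by (simp add: G_def inner_gram_ntk_mult)
    then show ?thesis
      using norm_gram_ntk_mult_le[of \<phi> X v] by (simp add: G_def T_def algebra_simps)
  qed
  have "c / (T * B^2) \<le> 1"
    using \<open>0 < c\<close> \<open>c * T \<le> 1\<close> \<open>1 \<le> T\<close> \<open>1 \<le> B\<close>
    by (smt (verit, best) divide_le_eq_1 le_divide_eq_1 mult_le_cancel_left1 one_le_power)
  moreover have "0 < c / (T * B^2)"
    using \<open>0 < c\<close> \<open>1 \<le> T\<close> \<open>1 \<le> B\<close> by simp
  moreover have "norm (e (Suc m))^2 \<le> (1 - c / (T * B^2)) * norm (e m)^2" for m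
    unfolding step_e
    by (rule norm_diff_scaleR_le[where G="(*v) G", OF above below \<open>0 < c\<close> \<open>c * T \<le> 1\<close>])
       (use \<open>1 \<le> T\<close> \<open>1 \<le> B\<close> in auto)
  ultimately have "e \<longlonglongrightarrow> 0"
    by (intro LIMSEQ_zero_if_norm_sq_contracts) auto
  then have "(\<lambda>m. f0 x - k x \<bullet> (matrix_inv G *v (e 0 - e m))) \<longlonglongrightarrow> f0 x - k x \<bullet> (matrix_inv G *v (e 0 - 0))"
    by (intro tendsto_intros bounded_linear.tendsto[OF matrix_vector_mul_bounded_linear])
  then have "ntk_train (ntk \<phi>) X \<eta> y f0 x = f0 x - k x \<bullet> (matrix_inv G *v e 0)"
    unfolding ntk_train_def f_eq[symmetric] f_def diff_zero by (rule limI)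
  then show ?thesis
    by (simp add: e_def f_def k_def G_def matrix_vector_mult_diff_distrib inner_diff_right)
qed

lemma datavec_ntk_train_gram:
  fixes \<phi> :: "'x \<Rightarrow> 'h::real_inner" and X X' :: "'n::finite \<Rightarrow> 'x"
  assumes "invertible (gram (ntk \<phi>) X X)"
    and "0 < \<eta>" "\<eta> < real CARD('n) / (2 * (1 + (\<Sum>j\<in>UNIV. norm (\<phi> (X j))^2)))"
  shows "datavec (ntk_train (ntk \<phi>) X \<eta> y f0) X' =
    datavec f0 X' + (gram (ntk \<phi>) X' X ** matrix_inv (gram (ntk \<phi>) X X)) *v (y - datavec f0 X)"
  by (simp add: vec_eq_iff datavec_def ntk_train_eq[OF assms] matrix_vector_mul_assoc[symmetric])
     (simp add: matrix_vector_mult_def inner_vec_def gram_def datavec_def)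

section \<open>Square-integrable random variables\<close>

lemma integrable_mult_if_square_integrable:
  fixes f g :: "'a \<Rightarrow> real"
  assumes "f \<in> borel_measurable M" "g \<in> borel_measurable M"
    and "integrable M (\<lambda>x. (f x)^2)" "integrable M (\<lambda>x. (g x)^2)"
  shows "integrable M (\<lambda>x. f x * g x)"
proof (rule Bochner_Integration.integrable_bound)
  show "integrable M (\<lambda>x. (f x)^2 + (g x)^2)" using assms by simp
  show "AE x in M. norm (f x * g x) \<le> norm ((f x)^2 + (g x)^2)"
  proof (intro AE_I2)
    fix x
    have "2 * (\<bar>f x\<bar> * \<bar>g x\<bar>) \<le> (f x)^2 + (g x)^2"
      using sum_squares_bound[of "\<bar>f x\<bar>" "\<bar>g x\<bar>"] by (simp add: mult.assoc)
    moreover have "0 \<le> \<bar>f x\<bar> * \<bar>g x\<bar>" by simp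
    ultimately have "\<bar>f x\<bar> * \<bar>g x\<bar> \<le> (f x)^2 + (g x)^2" by linarith
    then show "norm (f x * g x) \<le> norm ((f x)^2 + (g x)^2)"
      by (simp add: abs_mult)
  qed
qed (use assms in simp)

lemma integral_mult_le_sqrt:
  fixes f g :: "'a \<Rightarrow> real"
  assumes [measurable]: "f \<in> borel_measurable M" "g \<in> borel_measurable M"
    and f2: "integrable M (\<lambda>x. (f x)^2)" and g2: "integrable M (\<lambda>x. (g x)^2)"
  shows "(\<integral>x. f x * g x \<partial>M) \<le> sqrt (\<integral>x. (f x)^2 \<partial>M) * sqrt (\<integral>x. (g x)^2 \<partial>M)"
proof -
  have int_fg: "integrable M (\<lambda>x. \<bar>f x\<bar> * \<bar>g x\<bar>)"
    using integrable_abs[OF integrable_mult_if_square_integrable[OF assms]] by (simp add: abs_mult)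
  have nn: "(\<integral>\<^sup>+x. ennreal (h x) \<partial>M) = ennreal (\<integral>x. h x \<partial>M)"
    if "integrable M h" "\<And>x. 0 \<le> h x" for h :: "'a \<Rightarrow> real"
    using that by (intro nn_integral_eq_integral) auto
  have "ennreal ((\<integral>x. \<bar>f x\<bar> * \<bar>g x\<bar> \<partial>M)^2) = (\<integral>\<^sup>+x. ennreal \<bar>f x\<bar> * ennreal \<bar>g x\<bar> \<partial>M)^2"
  proof -
    have "(\<integral>\<^sup>+x. ennreal \<bar>f x\<bar> * ennreal \<bar>g x\<bar> \<partial>M) = ennreal (\<integral>x. \<bar>f x\<bar> * \<bar>g x\<bar> \<partial>M)"
      by (simp add: nn[OF int_fg, symmetric] ennreal_mult)
    then show ?thesis by (simp add: ennreal_power)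
  qed
  also have "\<dots> \<le> (\<integral>\<^sup>+x. ennreal \<bar>f x\<bar> ^ 2 \<partial>M) * (\<integral>\<^sup>+x. ennreal \<bar>g x\<bar> ^ 2 \<partial>M)"
    by (rule Cauchy_Schwarz_nn_integral) simp_all
  also have "\<dots> = ennreal ((\<integral>x. (f x)^2 \<partial>M) * (\<integral>x. (g x)^2 \<partial>M))"
    using nn[OF f2] nn[OF g2] by (simp add: ennreal_power ennreal_mult)
  finally have "(\<integral>x. \<bar>f x\<bar> * \<bar>g x\<bar> \<partial>M)^2 \<le> (\<integral>x. (f x)^2 \<partial>M) * (\<integral>x. (g x)^2 \<partial>M)"
    by (simp add: ennreal_le_iff)
  then have "(\<integral>x. \<bar>f x\<bar> * \<bar>g x\<bar> \<partial>M) \<le> sqrt (\<integral>x. (f x)^2 \<partial>M) * sqrt (\<integral>x. (g x)^2 \<partial>M)"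
    by (metis real_le_rsqrt real_sqrt_mult)
  moreover have "(\<integral>x. f x * g x \<partial>M) \<le> (\<integral>x. \<bar>f x\<bar> * \<bar>g x\<bar> \<partial>M)"
    using int_fg integrable_mult_if_square_integrable[OF assms]
    by (intro integral_mono) (auto simp: abs_mult[symmetric])
  ultimately show ?thesis by linarith
qed

lemma square_integrable_add:
  fixes f g :: "'a \<Rightarrow> real"
  assumes "f \<in> borel_measurable M" "g \<in> borel_measurable M"
    and "integrable M (\<lambda>x. (f x)^2)" "integrable M (\<lambda>x. (g x)^2)"
  shows "integrable M (\<lambda>x. (f x + g x)^2)"
proof -
  have "(\<lambda>x. (f x + g x)^2) = (\<lambda>x. (f x)^2 + 2 * (f x * g x) + (g x)^2)"
    by (simp add: fun_eq_iff power2_sum)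
  then show ?thesis
    using assms integrable_mult_if_square_integrable[OF assms] by simp
qed

lemma sqrt_integral_square_add_le:
  fixes f g :: "'a \<Rightarrow> real"
  assumes "f \<in> borel_measurable M" "g \<in> borel_measurable M"
    and "integrable M (\<lambda>x. (f x)^2)" "integrable M (\<lambda>x. (g x)^2)"
  shows "sqrt (\<integral>x. (f x + g x)^2 \<partial>M) \<le> sqrt (\<integral>x. (f x)^2 \<partial>M) + sqrt (\<integral>x. (g x)^2 \<partial>M)"
proof -
  have "(\<integral>x. (f x + g x)^2 \<partial>M) = (\<integral>x. (f x)^2 + 2 * (f x * g x) + (g x)^2 \<partial>M)"
    by (simp add: power2_sum mult.assoc add_ac)
  also have "\<dots> = (\<integral>x. (f x)^2 \<partial>M) + 2 * (\<integral>x. f x * g x \<partial>M) + (\<integral>x. (g x)^2 \<partial>M)"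
    using assms integrable_mult_if_square_integrable[OF assms] by simp
  also have "\<dots> \<le> (sqrt (\<integral>x. (f x)^2 \<partial>M) + sqrt (\<integral>x. (g x)^2 \<partial>M))^2"
    using integral_mult_le_sqrt[OF assms] by (simp add: power2_sum)
  finally have "sqrt (\<integral>x. (f x + g x)^2 \<partial>M) \<le> sqrt ((sqrt (\<integral>x. (f x)^2 \<partial>M) + sqrt (\<integral>x. (g x)^2 \<partial>M))^2)"
    by (rule real_sqrt_le_mono)
  then show ?thesis by simp
qed

lemma abs_sqrt_integral_square_diff_le:
  fixes f g :: "'a \<Rightarrow> real"
  assumes f: "f \<in> borel_measurable M" "integrable M (\<lambda>x. (f x)^2)"
    and g: "g \<in> borel_measurable M" "integrable M (\<lambda>x. (g x)^2)"
  shows "\<bar>sqrt (\<integral>x. (f x)^2 \<partial>M) - sqrt (\<integral>x. (f x + g x)^2 \<partial>M)\<bar> \<le> sqrt (\<integral>x. (g x)^2 \<partial>M)"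
proof -
  have "sqrt (\<integral>x. ((f x + g x) + - g x)^2 \<partial>M) \<le> sqrt (\<integral>x. (f x + g x)^2 \<partial>M) + sqrt (\<integral>x. (- g x)^2 \<partial>M)"
    using f g by (intro sqrt_integral_square_add_le square_integrable_add) auto
  moreover have "sqrt (\<integral>x. (f x + g x)^2 \<partial>M) \<le> sqrt (\<integral>x. (f x)^2 \<partial>M) + sqrt (\<integral>x. (g x)^2 \<partial>M)"
    using f g by (intro sqrt_integral_square_add_le)
  ultimately show ?thesis by simp
qed

lemma sqrt_integral_square_mono:
  fixes f g :: "'a \<Rightarrow> real"
  assumes "integrable M (\<lambda>x. (f x)^2)" "integrable M (\<lambda>x. (g x)^2)" "\<And>x. \<bar>f x\<bar> \<le> g x"
  shows "sqrt (\<integral>x. (f x)^2 \<partial>M) \<le> sqrt (\<integral>x. (g x)^2 \<partial>M)"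
  using assms by (intro real_sqrt_le_mono integral_mono) (auto, metis abs_ge_zero power2_abs power_mono)

definition centered_L2 :: "'a measure \<Rightarrow> ('a \<Rightarrow> real) \<Rightarrow> bool" where
  "centered_L2 M f \<longleftrightarrow> f \<in> borel_measurable M \<and> integrable M (\<lambda>x. (f x)^2) \<and> (\<integral>x. f x \<partial>M) = 0"

definition centered_L2_vec :: "'a measure \<Rightarrow> ('a \<Rightarrow> real^'n) \<Rightarrow> bool" where
  "centered_L2_vec M v \<longleftrightarrow> (\<forall>k. centered_L2 M (\<lambda>x. v x $ k))"

context finite_measure
begin

lemma centered_L2_add:
  assumes "centered_L2 M f" "centered_L2 M g"
  shows "centered_L2 M (\<lambda>x. f x + g x)"
proof -
  have "integrable M f" "integrable M g"
    using assms square_integrable_imp_integrable by (auto simp: centered_L2_def)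
  then show ?thesis
    using assms square_integrable_add[of f M g] by (auto simp: centered_L2_def)
qed

lemma centered_L2_mult_left: "centered_L2 M f \<Longrightarrow> centered_L2 M (\<lambda>x. c * f x)"
  by (simp add: centered_L2_def power_mult_distrib borel_measurable_times)

lemma centered_L2_sum: "(\<And>i. i \<in> I \<Longrightarrow> centered_L2 M (f i)) \<Longrightarrow> centered_L2 M (\<lambda>x. \<Sum>i\<in>I. f i x)"
  by (induction I rule: infinite_finite_induct) (auto simp: centered_L2_add centered_L2_def[of _ "\<lambda>_. 0"])

lemma centered_L2_vec_add:
  "centered_L2_vec M v \<Longrightarrow> centered_L2_vec M w \<Longrightarrow> centered_L2_vec M (\<lambda>x. v x + w x)"
  by (simp add: centered_L2_vec_def centered_L2_add)

lemma centered_L2_vec_scaleR: "centered_L2_vec M v \<Longrightarrow> centered_L2_vec M (\<lambda>x. c *\<^sub>R v x)"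
  by (simp add: centered_L2_vec_def centered_L2_mult_left)

lemma centered_L2_vec_diff:
  "centered_L2_vec M v \<Longrightarrow> centered_L2_vec M w \<Longrightarrow> centered_L2_vec M (\<lambda>x. v x - w x)"
  using centered_L2_vec_add[of v "\<lambda>x. (-1) *\<^sub>R w x"] centered_L2_vec_scaleR[of w "-1"] by simp

lemma centered_L2_vec_matrix_vector_mult:
  "centered_L2_vec M v \<Longrightarrow> centered_L2_vec M (\<lambda>x. A *v v x)"
  by (auto simp: centered_L2_vec_def matrix_vector_mult_def intro!: centered_L2_sum centered_L2_mult_left)

end

lemma (in prob_space) lcb_eq_of_centered:
  assumes "\<And>z. Q z x = c + f z" "centered_L2 M f"
  shows "lcb M Q x = c - sqrt (\<integral>z. (f z)^2 \<partial>M)"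
proof -
  have "integrable M f"
    using assms(2) square_integrable_imp_integrable by (auto simp: centered_L2_def)
  then show ?thesis
    using assms by (simp add: lcb_def ens_var_def ens_mean_def centered_L2_def prob_space)
qed

section \<open>Affine matrix recursions\<close>

lemma sum_matrix_vector_mult: "(\<Sum>k\<in>S. A k) *v (v::'a::comm_semiring_1^'n) = (\<Sum>k\<in>S. A k *v v)"
  by (induction S rule: infinite_finite_induct) (simp_all add: matrix_vector_mult_add_rdistrib)

lemma geom_sum_mult_vec: "geom_sum \<gamma> C t *v v = (\<Sum>k\<le>t. \<gamma>^k *\<^sub>R (matpow C k *v v))"
  by (simp add: geom_sum_def sum_matrix_vector_mult scaleR_matrix_vector_assoc)

lemma geom_sum_Suc_mult_vec:
  "geom_sum \<gamma> C (Suc t) *v v = v + \<gamma> *\<^sub>R (C *v (geom_sum \<gamma> C t *v v))"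
  unfolding geom_sum_mult_vec sum.atMost_Suc_shift
  by (simp add: linear_sum[OF matrix_vector_mul_linear] scaleR_sum_right
      matrix_vector_mult_scaleR matrix_vector_mul_assoc)

lemma affine_recurrence_eq:
  fixes x :: "nat \<Rightarrow> real^'n"
  assumes "\<And>t. x (Suc t) = b + \<gamma> *\<^sub>R (C *v x t)"
  shows "x (Suc t) = geom_sum \<gamma> C t *v b + \<gamma>^Suc t *\<^sub>R (matpow C (Suc t) *v x 0)"
proof (induction t)
  case 0
  then show ?case by (simp add: assms geom_sum_def)
next
  case (Suc t)
  then show ?case
    by (subst assms) (simp add: geom_sum_Suc_mult_vec matrix_vector_right_distrib
        matrix_vector_mult_scaleR matrix_vector_mul_assoc algebra_simps)
qed

lemma norm_matpow_mult_le: "norm (matpow C k *v v) \<le> onorm ((*v) C) ^ k * norm v"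
proof (induction k)
  case (Suc k)
  have "norm (matpow C (Suc k) *v v) \<le> onorm ((*v) C) * norm (matpow C k *v v)"
    by (simp add: matrix_vector_mul_assoc[symmetric] onorm)
  also have "\<dots> \<le> onorm ((*v) C) * (onorm ((*v) C) ^ k * norm v)"
    by (rule mult_left_mono[OF Suc]) (simp add: onorm_pos_le)
  finally show ?case by (simp add: mult.assoc)
qed simp

lemma norm_scaleR_matpow_mult_le:
  "0 \<le> \<gamma> \<Longrightarrow> norm (\<gamma>^k *\<^sub>R (matpow C k *v v)) \<le> (\<gamma> * onorm ((*v) C))^k * norm v"
  using mult_left_mono[OF norm_matpow_mult_le, of "\<gamma>^k" C k v]
  by (simp add: power_mult_distrib mult.assoc)

section \<open>Pessimistic policy evaluation with an NTK ensemble\<close>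

definition regression_residual :: "real^'n^'n \<Rightarrow> ('n \<Rightarrow> 'x) \<Rightarrow> ('n \<Rightarrow> 'x) \<Rightarrow> ('x \<Rightarrow> real) \<Rightarrow> real^'n" where
  "regression_residual C X X' f = datavec f X' - C *v datavec f X"

locale ntk_ensemble = prob_space M for M :: "'z measure" +
  fixes \<Theta> :: "'x \<Rightarrow> 'x \<Rightarrow> real" and X X' :: "'n::finite \<Rightarrow> 'x" and \<eta> :: real
    and C :: "real^'n^'n" and Q0 :: "'z \<Rightarrow> 'x \<Rightarrow> real"
  assumes Q0_centered: "\<And>x. centered_L2 M (\<lambda>z. Q0 z x)"
    and datavec_ntk_train: "\<And>y f0. datavec (ntk_train \<Theta> X \<eta> y f0) X' = datavec f0 X' + C *v (y - datavec f0 X)"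
begin

lemma centered_L2_vec_datavec_Q0: "centered_L2_vec M (\<lambda>z. datavec (Q0 z) Y)"
  by (simp add: centered_L2_vec_def datavec_def Q0_centered)

lemma centered_L2_vec_regression_residual: "centered_L2_vec M (\<lambda>z. regression_residual C X X' (Q0 z))"
  unfolding regression_residual_def
  by (intro centered_L2_vec_diff centered_L2_vec_matrix_vector_mult centered_L2_vec_datavec_Q0)

lemma datavec_pe_indep_Suc:
  "datavec (pe_indep \<Theta> X X' \<eta> R \<gamma> Q0 (Suc t) z) X' =
     geom_sum \<gamma> C t *v (C *v R) + geom_sum \<gamma> C t *v regression_residual C X X' (Q0 z)
     + \<gamma>^Suc t *\<^sub>R (matpow C (Suc t) *v datavec (Q0 z) X')"
proof -
  have "datavec (pe_indep \<Theta> X X' \<eta> R \<gamma> Q0 (Suc t) z) X' =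
     (regression_residual C X X' (Q0 z) + C *v R) + \<gamma> *\<^sub>R (C *v datavec (pe_indep \<Theta> X X' \<eta> R \<gamma> Q0 t z) X')" for t
    by (simp add: datavec_ntk_train regression_residual_def matrix_vector_right_distrib
        matrix_vector_mult_diff_distrib matrix_vector_mult_scaleR algebra_simps)
  from affine_recurrence_eq[of "\<lambda>t. datavec (pe_indep \<Theta> X X' \<eta> R \<gamma> Q0 t z) X'", OF this]
  show ?thesis by (simp add: matrix_vector_right_distrib add_ac)
qed

lemma integrable_norm_datavec_Q0_square: "integrable M (\<lambda>z. norm (datavec (Q0 z) Y)^2)"
proof -
  have "norm (datavec (Q0 z) Y)^2 = (\<Sum>j\<in>UNIV. (Q0 z (Y j))^2)" for z
    by (simp only: power2_norm_eq_inner) (simp add: inner_vec_def datavec_def power2_eq_square)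
  then show ?thesis
    using Q0_centered by (simp add: centered_L2_def)
qed

lemma lcb_pe_indep_bound:
  assumes "0 \<le> \<gamma>"
  shows "\<exists>K. \<forall>t. norm ((\<chi> k. lcb M (pe_indep \<Theta> X X' \<eta> R \<gamma> Q0 (Suc t)) (X' k))
      - (geom_sum \<gamma> C t *v (C *v R)
         - (\<chi> k. sqrt (ens_mean M (\<lambda>z. ((geom_sum \<gamma> C t *v regression_residual C X X' (Q0 z)) $ k)^2)))))
    \<le> K * (\<gamma> * onorm ((*v) C))^t"
proof -
  define \<rho> where "\<rho> = \<gamma> * onorm ((*v) C)"
  define W where "W = (\<integral>z. norm (datavec (Q0 z) X')^2 \<partial>M)"
  have "0 \<le> \<rho>"
    using assms onorm_pos_le[OF matrix_vector_mul_bounded_linear, of C] by (simp add: \<rho>_def)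
  have "norm ((\<chi> k. lcb M (pe_indep \<Theta> X X' \<eta> R \<gamma> Q0 (Suc t)) (X' k))
      - (geom_sum \<gamma> C t *v (C *v R)
         - (\<chi> k. sqrt (ens_mean M (\<lambda>z. ((geom_sum \<gamma> C t *v regression_residual C X X' (Q0 z)) $ k)^2)))))
    \<le> (real CARD('n) * \<rho> * sqrt W) * \<rho>^t" (is "norm ?V \<le> _") for t
  proof -
    define a where "a z = geom_sum \<gamma> C t *v regression_residual C X X' (Q0 z)" for z
    define b where "b z = \<gamma>^Suc t *\<^sub>R (matpow C (Suc t) *v datavec (Q0 z) X')" for z
    have "centered_L2_vec M a" "centered_L2_vec M b"
      unfolding a_def b_def
      by (intro centered_L2_vec_matrix_vector_mult centered_L2_vec_scaleR
          centered_L2_vec_regression_residual centered_L2_vec_datavec_Q0)+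
    then have a_k: "centered_L2 M (\<lambda>z. a z $ k)" and b_k: "centered_L2 M (\<lambda>z. b z $ k)" for k
      by (simp_all add: centered_L2_vec_def)
    have b_k_bound: "sqrt (\<integral>z. (b z $ k)^2 \<partial>M) \<le> \<rho>^Suc t * sqrt W" for k
    proof -
      have "\<bar>b z $ k\<bar> \<le> \<rho>^Suc t * norm (datavec (Q0 z) X')" for z
        using component_le_norm_cart[of "b z" k] norm_scaleR_matpow_mult_le[OF assms]
        unfolding b_def \<rho>_def by (rule order_trans)
      then have "sqrt (\<integral>z. (b z $ k)^2 \<partial>M) \<le> sqrt (\<integral>z. (\<rho>^Suc t * norm (datavec (Q0 z) X'))^2 \<partial>M)"
        using b_k integrable_norm_datavec_Q0_square[of X']
        by (intro sqrt_integral_square_mono) (simp_all add: centered_L2_def power_mult_distrib)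
      also have "\<dots> = \<rho>^Suc t * sqrt W"
        using \<open>0 \<le> \<rho>\<close> by (simp add: W_def power_mult_distrib real_sqrt_mult)
      finally show ?thesis .
    qed
    have V_k: "\<bar>?V $ k\<bar> \<le> \<rho>^Suc t * sqrt W" for k
    proof -
      have "lcb M (pe_indep \<Theta> X X' \<eta> R \<gamma> Q0 (Suc t)) (X' k)
          = (geom_sum \<gamma> C t *v (C *v R)) $ k - sqrt (\<integral>z. (a z $ k + b z $ k)^2 \<partial>M)"
        using datavec_pe_indep_Suc[of R \<gamma> t]
        by (intro lcb_eq_of_centered centered_L2_add a_k b_k)
           (simp add: vec_eq_iff datavec_def a_def b_def)
      then have "?V $ k = sqrt (\<integral>z. (a z $ k)^2 \<partial>M) - sqrt (\<integral>z. (a z $ k + b z $ k)^2 \<partial>M)"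
        by (simp add: a_def ens_mean_def)
      also have "\<bar>\<dots>\<bar> \<le> sqrt (\<integral>z. (b z $ k)^2 \<partial>M)"
        using a_k b_k by (intro abs_sqrt_integral_square_diff_le) (simp_all add: centered_L2_def)
      finally show ?thesis using b_k_bound[of k] by linarith
    qed
    have "norm ?V \<le> (\<Sum>k\<in>UNIV. \<bar>?V $ k\<bar>)" by (rule norm_le_l1_cart)
    also have "\<dots> \<le> (\<Sum>k\<in>(UNIV :: 'n set). \<rho>^Suc t * sqrt W)" by (rule sum_mono) (rule V_k)
    finally show ?thesis by (simp add: mult_ac)
  qed
  then show ?thesis unfolding \<rho>_def by blast
qed

lemma lcb_pe_shared_bound:
  assumes "0 \<le> \<gamma>"
  shows "\<exists>K. \<forall>t. norm ((\<chi> k. lcb M (pe_shared M \<Theta> X X' \<eta> R \<gamma> Q0 (Suc t)) (X' k))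
      - (geom_sum \<gamma> C t *v (C *v R)
         - geom_sum \<gamma> C t *v (\<chi> k. sqrt (ens_mean M (\<lambda>z. (regression_residual C X X' (Q0 z) $ k)^2)))))
    \<le> K * (\<gamma> * onorm ((*v) C))^t"
proof -
  define L where "L t = datavec (lcb M (pe_shared M \<Theta> X X' \<eta> R \<gamma> Q0 t)) X'" for t
  define \<sigma> where "\<sigma> = (\<chi> k. sqrt (ens_mean M (\<lambda>z. (regression_residual C X X' (Q0 z) $ k)^2)))"
  have "L (Suc t) = (C *v R - \<sigma>) + \<gamma> *\<^sub>R (C *v L t)" for t
  proof -
    have "datavec (pe_shared M \<Theta> X X' \<eta> R \<gamma> Q0 (Suc t) z) X' =
        (C *v R + \<gamma> *\<^sub>R (C *v L t)) + regression_residual C X X' (Q0 z)" for z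
      by (simp add: L_def datavec_ntk_train regression_residual_def matrix_vector_right_distrib
          matrix_vector_mult_diff_distrib matrix_vector_mult_scaleR algebra_simps)
    then have "lcb M (pe_shared M \<Theta> X X' \<eta> R \<gamma> Q0 (Suc t)) (X' k) =
        (C *v R + \<gamma> *\<^sub>R (C *v L t)) $ k - sqrt (\<integral>z. (regression_residual C X X' (Q0 z) $ k)^2 \<partial>M)" for k
      using centered_L2_vec_regression_residual
      by (intro lcb_eq_of_centered) (auto simp: vec_eq_iff datavec_def centered_L2_vec_def)
    then show ?thesis by (simp add: vec_eq_iff L_def datavec_def \<sigma>_def ens_mean_def)
  qed
  then have "L (Suc t) = geom_sum \<gamma> C t *v (C *v R - \<sigma>) + \<gamma>^Suc t *\<^sub>R (matpow C (Suc t) *v L 0)" for t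
    by (rule affine_recurrence_eq)
  then have "norm ((\<chi> k. lcb M (pe_shared M \<Theta> X X' \<eta> R \<gamma> Q0 (Suc t)) (X' k))
      - (geom_sum \<gamma> C t *v (C *v R) - geom_sum \<gamma> C t *v \<sigma>))
    \<le> (\<gamma> * onorm ((*v) C) * norm (L 0)) * (\<gamma> * onorm ((*v) C))^t" for t
    using norm_scaleR_matpow_mult_le[OF assms, of "Suc t" C "L 0"]
    by (simp add: L_def datavec_def matrix_vector_mult_diff_distrib mult_ac)
  then show ?thesis unfolding \<sigma>_def by blast
qed

end

theorem theorem1:
  fixes M :: "'z measure"
    and Q0 :: "'z \<Rightarrow> ('s \<times> 'a) \<Rightarrow> real"
    and \<phi> :: "('s \<times> 'a) \<Rightarrow> 'h::real_inner"
    and s :: "'n::finite \<Rightarrow> 's" and a :: "'n \<Rightarrow> 'a" and r :: "'n \<Rightarrow> real" and s' :: "'n \<Rightarrow> 's"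
    and \<pi> :: "'s \<Rightarrow> 'a"
    and \<gamma> :: real
  defines "\<Theta> \<equiv> ntk \<phi>"
    and "X \<equiv> (\<lambda>k. (s k, a k))"
    and "X' \<equiv> (\<lambda>k. (s' k, \<pi> (s' k)))"
    and "R \<equiv> (\<chi> k. r k)"
    and "C \<equiv> gram (ntk \<phi>) (\<lambda>k. (s' k, \<pi> (s' k))) (\<lambda>k. (s k, a k)) ** matrix_inv (gram (ntk \<phi>) (\<lambda>k. (s k, a k)) (\<lambda>k. (s k, a k)))"
  assumes M: "prob_space M"
    and meas: "\<And>x. (\<lambda>z. Q0 z x) \<in> borel_measurable M"
    and sq_int: "\<And>x. integrable M (\<lambda>z. (Q0 z x)^2)"
    and centered: "\<And>x. ens_mean M (\<lambda>z. Q0 z x) = 0"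
    and inv: "invertible (gram \<Theta> X X)"
    and gamma_nonneg: "0 \<le> \<gamma>" and gamma_lt1: "\<gamma> < 1"
    and contr: "\<gamma> * onorm (\<lambda>v. C *v v) < 1"
  shows "\<exists>\<eta>0>0. \<forall>\<eta>. 0 < \<eta> \<and> \<eta> < \<eta>0 \<longrightarrow>
     (\<exists>K. \<forall>t.
        norm ((\<chi> k. lcb M (pe_indep \<Theta> X X' \<eta> R \<gamma> Q0 (Suc t)) (X' k))
              - (geom_sum \<gamma> C t *v (C *v R)
                 - (\<chi> k. sqrt (ens_mean M (\<lambda>z.
                      ((geom_sum \<gamma> C t *v (datavec (Q0 z) X' - C *v datavec (Q0 z) X)) $ k)^2)))))
          \<le> K * (\<gamma> * onorm (\<lambda>v. C *v v)) ^ t)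
   \<and> (\<exists>K. \<forall>t.
        norm ((\<chi> k. lcb M (pe_shared M \<Theta> X X' \<eta> R \<gamma> Q0 (Suc t)) (X' k))
              - (geom_sum \<gamma> C t *v (C *v R)
                 - geom_sum \<gamma> C t *v (\<chi> k. sqrt (ens_mean M (\<lambda>z.
                      ((datavec (Q0 z) X' - C *v datavec (Q0 z) X) $ k)^2)))))
          \<le> K * (\<gamma> * onorm (\<lambda>v. C *v v)) ^ t)"
proof -
  define \<eta>0 where "\<eta>0 = real CARD('n) / (2 * (1 + (\<Sum>j\<in>UNIV. norm (\<phi> (X j))^2)))"
  have "0 < \<eta>0" by (simp add: \<eta>0_def add_pos_nonneg sum_nonneg)
  have ensemble: "ntk_ensemble M \<Theta> X X' \<eta> C Q0" if "0 < \<eta>" "\<eta> < \<eta>0" for \<eta>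
  proof (intro ntk_ensemble.intro ntk_ensemble_axioms.intro M)
    show "centered_L2 M (\<lambda>z. Q0 z x)" for x
      using meas sq_int centered by (simp add: centered_L2_def ens_mean_def)
    show "datavec (ntk_train \<Theta> X \<eta> y f0) X' = datavec f0 X' + C *v (y - datavec f0 X)" for y f0
      using datavec_ntk_train_gram[OF inv[unfolded assms(1)] that[unfolded \<eta>0_def]]
      unfolding assms(1-3,5) .
  qed
  show ?thesis
    using ntk_ensemble.lcb_pe_indep_bound[OF ensemble gamma_nonneg]
      ntk_ensemble.lcb_pe_shared_bound[OF ensemble gamma_nonneg] \<open>0 < \<eta>0\<close>
    unfolding regression_residual_def by blast
qed

end
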